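(* For every positive integer $h$ there are $\varepsilon_0=\varepsilon_0(h)>0$ and $\alpha=\alpha(h)>0$ with the following property. For every oriented graph $H$ on $h$ vertices that is not $2$-colorable, for every $0<\varepsilon<\varepsilon_0$, there is $n_0=n_0(\varepsilon)$ such that for every $n\ge n_0$ there is a tournament $T$ on $n$ vertices which is $\varepsilon$-far from being $H$-free but contains at most $\varepsilon^{\alpha\log(1/\varepsilon)}n^h$ copies of $H$.
   Context: An oriented graph is a directed graph without loops with at most one edge between any two distinct vertices. An oriented graph $H$ is $2$-colorable if $V(H)$ can be partitioned into $2$ sets each inducing an acyclic digraph. A tournament $T$ on $n$ vertices is $\varepsilon$-far from being $H$-free if one must reverse the direction of at least $\varepsilon n^2$ edges of $T$ to obtain a tournament containing no copy of $H$; a copy of $H$ in $T$ is a (not necessarily induced) subgraph of $T$ isomorphic to $H$. *)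

theory Defs
  imports Complex_Main
begin

definition oriented_graph :: "nat \<Rightarrow> (nat \<times> nat) set \<Rightarrow> bool" where
  "oriented_graph n E \<longleftrightarrow> E \<subseteq> {..<n} \<times> {..<n}
     \<and> (\<forall>u. (u, u) \<notin> E) \<and> (\<forall>u v. (u, v) \<in> E \<longrightarrow> (v, u) \<notin> E)"

definition tournament :: "nat \<Rightarrow> (nat \<times> nat) set \<Rightarrow> bool" where
  "tournament n T \<longleftrightarrow> oriented_graph n T
     \<and> (\<forall>u<n. \<forall>v<n. u \<noteq> v \<longrightarrow> (u, v) \<in> T \<or> (v, u) \<in> T)"

definition induced :: "(nat \<times> nat) set \<Rightarrow> nat set \<Rightarrow> (nat \<times> nat) set" where
  "induced E A = {(u, v). (u, v) \<in> E \<and> u \<in> A \<and> v \<in> A}"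

definition two_colorable :: "nat \<Rightarrow> (nat \<times> nat) set \<Rightarrow> bool" where
  "two_colorable h H \<longleftrightarrow> (\<exists>A B. A \<union> B = {..<h} \<and> A \<inter> B = {}
      \<and> acyclic (induced H A) \<and> acyclic (induced H B))"

definition copies :: "nat \<Rightarrow> (nat \<times> nat) set \<Rightarrow> nat \<Rightarrow> (nat \<times> nat) set
                      \<Rightarrow> (nat set \<times> (nat \<times> nat) set) set" where
  "copies h H n T = {(f ` {..<h}, (\<lambda>(u, v). (f u, f v)) ` H) | f.
      inj_on f {..<h} \<and> f ` {..<h} \<subseteq> {..<n} \<and> (\<forall>(u, v)\<in>H. (f u, f v) \<in> T)}"

definition H_free :: "nat \<Rightarrow> (nat \<times> nat) set \<Rightarrow> nat \<Rightarrow> (nat \<times> nat) set \<Rightarrow> bool" where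
  "H_free h H n T \<longleftrightarrow> copies h H n T = {}"

definition reversals :: "(nat \<times> nat) set \<Rightarrow> (nat \<times> nat) set \<Rightarrow> nat" where
  "reversals T T' = card (T - T')"

definition far_from_free :: "real \<Rightarrow> nat \<Rightarrow> (nat \<times> nat) set \<Rightarrow> nat \<Rightarrow> (nat \<times> nat) set \<Rightarrow> bool" where
  "far_from_free \<epsilon> h H n T \<longleftrightarrow>
     (\<forall>T'. tournament n T' \<and> H_free h H n T' \<longrightarrow> real (reversals T T') \<ge> \<epsilon> * real n ^ 2)"

end

theory Submission
  imports Defs "HOL-Library.FuncSet"
begin

text \<open>
  For a linear order on the vertices of a digraph, only the backward edges matter: if they form a
  bipartite graph, each colour class is ordered by its edges and the digraph is 2-colorable. So for
  every order of \<open>H\<close> the backward edges contain an odd cycle. Among all orders choose one whose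
  backward edges \<open>B\<close> are minimal for the homomorphism preorder, and let \<open>K \<subseteq> B\<close> be a
  smallest subgraph to which \<open>B\<close> maps.

  Take parts indexed by the vertices of \<open>H\<close>, each a grid in \<open>\<int>\<^sup>d\<close>, and for a grid
  point \<open>x\<close> and a point \<open>a\<close> of a fixed sphere plant a copy of \<open>H\<close> on the points
  \<open>x + c(i) a\<close> of the parts \<open>i\<close>. The planted copies are edge-disjoint, because \<open>c\<close> is
  injective. Order the parts as \<open>H\<close> is ordered; the tournament \<open>T\<close> follows this order except
  on the planted backward edges. Any copy of \<open>H\<close> in \<open>T\<close> inherits an order from \<open>T\<close>, and
  its backward edges map to \<open>B\<close>; by minimality and rigidity of \<open>K\<close> it contains a cycle
  lying over a prescribed cycle of \<open>K\<close>. If \<open>c\<close> increases along that cycle, strict convexity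
  of the sphere forces the whole cycle onto one line, so three vertices of the copy are collinear,
  which is rare. For grids of side about \<open>h ^ d\<close> with \<open>d\<close> of order \<open>ln (1 / \<epsilon>)\<close>,
  a pigeonholed sphere is dense enough for the first part and the collinearity saves a factor
  \<open>h ^ (d * d)\<close> in the second.
\<close>

section \<open>Backward edges\<close>

definition hom :: "(nat \<times> nat) set \<Rightarrow> (nat \<times> nat) set \<Rightarrow> (nat \<Rightarrow> nat) \<Rightarrow> bool" where
  "hom X Y g \<longleftrightarrow> (\<forall>u v. (u, v) \<in> X \<longrightarrow> (g u, g v) \<in> Y)"

definition backward :: "(nat \<Rightarrow> nat) \<Rightarrow> (nat \<times> nat) set \<Rightarrow> (nat \<times> nat) set" where
  "backward \<rho> H = {(u, v) \<in> H. \<rho> v < \<rho> u}"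

definition bipartite :: "(nat \<times> nat) set \<Rightarrow> bool" where
  "bipartite X \<longleftrightarrow> (\<exists>col :: nat \<Rightarrow> bool. \<forall>u v. (u, v) \<in> X \<longrightarrow> col u \<noteq> col v)"

lemma hom_comp: "hom X Y f \<Longrightarrow> hom Y Z g \<Longrightarrow> hom X Z (g \<circ> f)"
  by (simp add: hom_def)

lemma bipartite_if_hom: "hom X Y f \<Longrightarrow> bipartite Y \<Longrightarrow> bipartite X"
  unfolding hom_def bipartite_def by (metis comp_apply)

lemma backward_subset: "backward \<rho> H \<subseteq> H"
  by (auto simp: backward_def)

text \<open>Inside one colour class no edge of \<open>H\<close> is backward, so
  \<open>\<rho>\<close> strictly increases along every edge there and no directed cycle fits into
  the class.\<close>

lemma two_colorable_if_bipartite_back: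
  assumes "oriented_graph h H" and inj: "inj_on \<rho> {..<h}" and "bipartite (backward \<rho> H)"
  shows "two_colorable h H"
proof -
  obtain col :: "nat \<Rightarrow> bool" where col: "\<And>u v. (u, v) \<in> backward \<rho> H \<Longrightarrow> col u \<noteq> col v"
    using assms(3) by (auto simp: bipartite_def)
  have *: "acyclic (induced H {v. v < h \<and> col v = b})" for b
  proof (rule acyclic_subset[OF wf_acyclic[OF wf_measure[of \<rho>]]])
    show "induced H {v. v < h \<and> col v = b} \<subseteq> measure \<rho>"
    proof (clarsimp simp: induced_def)
      fix u v assume uv: "(u, v) \<in> H" "u < h" "v < h" "col v = col u"
      have "u \<noteq> v" using uv(1) assms(1) by (auto simp: oriented_graph_def)
      hence "\<rho> u \<noteq> \<rho> v" using inj uv by (auto simp: inj_on_def)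
      moreover have "\<not> \<rho> v < \<rho> u" using col[of u v] uv by (auto simp: backward_def)
      ultimately show "\<rho> u < \<rho> v" by simp
    qed
  qed
  show ?thesis unfolding two_colorable_def
    by (rule exI[of _ "{v. v < h \<and> col v = True}"], rule exI[of _ "{v. v < h \<and> col v = False}"])
       (use *[of True] *[of False] in auto)
qed

section \<open>Cycles in non-bipartite graphs\<close>

text \<open>A vertex \<open>u\<close> whose only neighbour is \<open>v\<close> is harmless: colour
  the graph without the edge between them, then give \<open>u\<close> the colour opposite to
  \<open>v\<close>.\<close>

lemma minimal_not_bipartite_degree:
  assumes nb: "\<not> bipartite X" and irr: "\<And>u. (u, u) \<notin> X"
    and min: "\<And>Y. Y \<subset> X \<Longrightarrow> bipartite Y"
    and u: "(u, v) \<in> X \<union> X\<inverse>"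
  shows "\<exists>w. w \<noteq> v \<and> (u, w) \<in> X \<union> X\<inverse>"
proof (rule ccontr)
  assume no: "\<not> ?thesis"
  define Y where "Y = X - {(u, v), (v, u)}"
  have "Y \<subset> X" using u by (auto simp: Y_def)
  hence "bipartite Y" by (rule min)
  then obtain col :: "nat \<Rightarrow> bool" where col: "\<And>x y. (x, y) \<in> Y \<Longrightarrow> col x \<noteq> col y"
    unfolding bipartite_def by blast
  have "u \<noteq> v" using u irr by auto
  have "(col(u := \<not> col v)) x \<noteq> (col(u := \<not> col v)) y" if "(x, y) \<in> X" for x y
  proof (cases "x = u \<or> y = u")
    case True
    hence "(x, y) = (u, v) \<or> (x, y) = (v, u)" using that no by blast
    thus ?thesis using \<open>u \<noteq> v\<close> by fastforce
  next
    case False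
    hence "(x, y) \<in> Y" using that by (auto simp: Y_def)
    hence "col x \<noteq> col y" by (rule col)
    thus ?thesis using False by simp
  qed
  thus False using nb unfolding bipartite_def by blast
qed

text \<open>In a minimal non-bipartite subgraph no vertex has exactly one neighbour. So the first
  vertex of a longest path has a second neighbour, which lies on the path by maximality and closes a
  cycle. Orientations are forgotten throughout.\<close>

lemma exists_cycle_if_not_bipartite:
  assumes fin: "finite X" and irr: "\<And>u. (u, u) \<notin> X" and nb: "\<not> bipartite X"
  shows "\<exists>p. distinct p \<and> 3 \<le> length p \<and> set p \<subseteq> Field X
    \<and> (\<forall>i. Suc i < length p \<longrightarrow> (p ! i, p ! Suc i) \<in> X \<union> X\<inverse>)
    \<and> (p ! 0, p ! (length p - 1)) \<in> X \<union> X\<inverse>"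
proof -
  define Q where "Q Y \<longleftrightarrow> Y \<subseteq> X \<and> \<not> bipartite Y" for Y
  have "Q X" using nb by (simp add: Q_def)
  obtain Y where Y: "Q Y" and Ymin: "\<And>Z. Q Z \<Longrightarrow> card Y \<le> card Z"
    using ex_has_least_nat[of Q X card] \<open>Q X\<close> by blast
  have YX: "Y \<subseteq> X" and finY: "finite Y" using Y fin finite_subset by (auto simp: Q_def)
  have deg: "\<exists>w. w \<noteq> v \<and> (u, w) \<in> Y \<union> Y\<inverse>" if "(u, v) \<in> Y \<union> Y\<inverse>" for u v
  proof (rule minimal_not_bipartite_degree[OF _ _ _ that])
    show "\<not> bipartite Y" using Y by (simp add: Q_def)
    show "(u, u) \<notin> Y" for u using irr YX by auto
    fix Z assume "Z \<subset> Y"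
    show "bipartite Z"
    proof (rule ccontr)
      assume "\<not> bipartite Z"
      hence "Q Z" using \<open>Z \<subset> Y\<close> YX by (auto simp: Q_def)
      thus False using Ymin psubset_card_mono[OF finY \<open>Z \<subset> Y\<close>] by fastforce
    qed
  qed
  define path where "path p \<longleftrightarrow> distinct p \<and> 2 \<le> length p \<and> set p \<subseteq> Field Y
    \<and> (\<forall>i. Suc i < length p \<longrightarrow> (p ! i, p ! Suc i) \<in> Y \<union> Y\<inverse>)" for p
  have "Y \<noteq> {}" using Y by (auto simp: Q_def bipartite_def)
  then obtain a b where ab: "(a, b) \<in> Y" by auto
  have "a \<noteq> b" using ab irr YX by auto
  hence "path [a, b]" using ab by (auto simp: path_def Field_def less_Suc_eq)
  have finF: "finite (Field Y)" using finY by (rule finite_Field)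
  have bnd: "\<forall>p. path p \<longrightarrow> length p \<le> card (Field Y)"
    using card_mono[OF finF] by (metis distinct_card path_def)
  obtain p where p: "path p" and pmax: "\<And>p'. path p' \<Longrightarrow> length p' \<le> length p"
    using ex_has_greatest_nat[of path "[a, b]" length "Suc (card (Field Y))"] \<open>path [a, b]\<close> bnd
    by (auto simp: less_Suc_eq_le)
  have edge: "(p ! i, p ! Suc i) \<in> Y \<union> Y\<inverse>" if "Suc i < length p" for i
    using p that by (auto simp: path_def)
  have len: "2 \<le> length p" and dp: "distinct p" and sp: "set p \<subseteq> Field Y"
    using p by (auto simp: path_def)
  obtain w where w: "w \<noteq> p ! 1" "(p ! 0, w) \<in> Y \<union> Y\<inverse>"
    using deg[of "p ! 0" "p ! 1"] edge[of 0] len by auto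
  have "w \<in> set p"
  proof (rule ccontr)
    assume "w \<notin> set p"
    have "((w # p) ! i, (w # p) ! Suc i) \<in> Y \<union> Y\<inverse>" if "Suc i < length (w # p)" for i
      using that edge w(2) by (cases i) auto
    moreover have "w \<in> Field Y" using w by (auto simp: Field_def)
    ultimately have "path (w # p)" using dp len sp \<open>w \<notin> set p\<close> by (auto simp: path_def)
    thus False using pmax by fastforce
  qed
  then obtain j where j: "j < length p" "w = p ! j" by (metis in_set_conv_nth)
  \<comment> \<open>The neighbour \<open>w\<close> is neither the start of the path nor its
    successor, so the initial segment up to \<open>w\<close> has at least three vertices.\<close>
  have "j \<noteq> 0" using w(2) irr YX j by (metis Un_iff converse_iff subsetD)
  moreover have "j \<noteq> 1" using w j by auto
  ultimately have j2: "2 \<le> j" by auto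
  have "distinct (take (Suc j) p)" "3 \<le> length (take (Suc j) p)"
    "set (take (Suc j) p) \<subseteq> Field X"
    using dp j j2 sp mono_Field[OF YX] set_take_subset[of "Suc j" p] by auto
  moreover have "\<forall>i. Suc i < length (take (Suc j) p) \<longrightarrow>
      (take (Suc j) p ! i, take (Suc j) p ! Suc i) \<in> X \<union> X\<inverse>"
    using edge YX by auto
  moreover have "(take (Suc j) p ! 0, take (Suc j) p ! (length (take (Suc j) p) - 1)) \<in> X \<union> X\<inverse>"
  proof -
    have "length (take (Suc j) p) = Suc j" using j by simp
    thus ?thesis using w j YX by auto
  qed
  ultimately show ?thesis by blast
qed

text \<open>The map \<open>\<phi> \<circ> \<eta>\<close>, composed with a homomorphism back from \<open>K\<close>, is an edge-surjective
  endomorphism of \<open>K\<close>, hence an automorphism, and \<open>\<zeta>\<close> undoes it.\<close>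

lemma exists_rigid_backward:
  assumes "finite H"
  shows "\<exists>\<rho> K \<phi>. inj_on \<rho> {..<h::nat} \<and> K \<subseteq> backward \<rho> H \<and> hom (backward \<rho> H) K \<phi> \<and>
    (\<forall>\<rho>' \<eta>. inj_on \<rho>' {..<h} \<and> hom (backward \<rho>' H) (backward \<rho> H) \<eta> \<longrightarrow>
       (\<exists>\<zeta>. hom K (backward \<rho>' H) \<zeta> \<and> (\<forall>v\<in>Field K. \<phi> (\<eta> (\<zeta> v)) = v)))"
proof -
  define I where "I = {\<rho> :: nat \<Rightarrow> nat. inj_on \<rho> {..<h}}"
  \<comment> \<open>Edge sets are collected instead of orders, so that this down-set in the
    homomorphism preorder is finite and one of least cardinality can be chosen.\<close>
  define below where "below \<rho> = {backward \<rho>' H | \<rho>'. \<rho>' \<in> I \<and> (\<exists>\<eta>. hom (backward \<rho>' H) (backward \<rho> H) \<eta>)}" for \<rho>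
  have finb: "finite (below \<rho>)" for \<rho>
    by (rule finite_subset[of _ "Pow H"]) (use assms backward_subset in \<open>auto simp: below_def\<close>)
  have "(\<lambda>x. x) \<in> I" by (auto simp: I_def)
  then obtain \<rho> where \<rho>: "\<rho> \<in> I" and \<rho>min: "\<And>\<rho>'. \<rho>' \<in> I \<Longrightarrow> card (below \<rho>) \<le> card (below \<rho>')"
    using ex_has_least_nat[of "\<lambda>\<rho>. \<rho> \<in> I" _ "\<lambda>\<rho>. card (below \<rho>)"] by blast
  define B where "B = backward \<rho> H"
  \<comment> \<open>A homomorphism into \<open>B\<close> shrinks the down-set; by minimality it does
    not shrink, so \<open>B\<close> itself lies below the other backward graph.\<close>
  have ret: "\<exists>g. hom B (backward \<rho>' H) g" if "\<rho>' \<in> I" "hom (backward \<rho>' H) B \<eta>" for \<rho>' \<eta>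
  proof -
    have "below \<rho>' \<subseteq> below \<rho>"
      using that hom_comp unfolding below_def B_def by blast
    hence "below \<rho>' = below \<rho>" using \<rho>min[OF that(1)] finb card_seteq by blast
    moreover have "hom B B (\<lambda>x. x)" by (simp add: hom_def)
    hence "B \<in> below \<rho>" unfolding below_def B_def using \<rho> by blast
    ultimately have "B \<in> below \<rho>'" by simp
    thus ?thesis unfolding below_def by blast
  qed
  define Q where "Q K \<longleftrightarrow> K \<subseteq> B \<and> (\<exists>\<phi>. hom B K \<phi>)" for K
  have "Q B" by (auto simp: Q_def hom_def intro!: exI[of _ "\<lambda>x. x"])
  then obtain K where K: "Q K" and Kmin: "\<And>K'. Q K' \<Longrightarrow> card K \<le> card K'"
    using ex_has_least_nat[of Q B card] by blast
  have KB: "K \<subseteq> B" using K by (simp add: Q_def)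
  hence "K \<subseteq> H" using backward_subset by (auto simp: B_def)
  hence finK: "finite K" using assms by (rule finite_subset)
  obtain \<phi> where \<phi>: "hom B K \<phi>" using K by (auto simp: Q_def)
  have "\<exists>\<zeta>. hom K (backward \<rho>' H) \<zeta> \<and> (\<forall>v\<in>Field K. \<phi> (\<eta> (\<zeta> v)) = v)"
    if \<rho>': "\<rho>' \<in> I" and \<eta>: "hom (backward \<rho>' H) B \<eta>" for \<rho>' \<eta>
  proof -
    obtain g where g: "hom B (backward \<rho>' H) g" using ret[OF \<rho>' \<eta>] by blast
    define \<theta> where "\<theta> = \<phi> \<circ> (\<eta> \<circ> g)"
    have \<theta>: "hom B K \<theta>" unfolding \<theta>_def by (intro hom_comp[OF _ \<phi>] hom_comp[OF g \<eta>])
    define K' where "K' = map_prod \<theta> \<theta> ` K"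
    have sub: "K' \<subseteq> K" using \<theta> KB by (auto simp: K'_def hom_def)
    have "hom K K' \<theta>" by (force simp: K'_def hom_def)
    \<comment> \<open>The image of \<open>K\<close> again receives a homomorphism from
      \<open>B\<close>, so it cannot have fewer edges than \<open>K\<close>.\<close>
    hence "Q K'" using hom_comp[OF \<phi>] sub KB unfolding Q_def by blast
    hence K': "K' = K" using sub Kmin finK card_seteq by blast
    have surj: "\<theta> ` Field K = Field K"
    proof -
      have "\<theta> ` Field K = Field K'" by (force simp: K'_def Field_def)
      thus ?thesis using K' by simp
    qed
    have inj: "inj_on \<theta> (Field K)"
      using eq_card_imp_inj_on[OF finite_Field[OF finK]] surj by metis
    define \<tau> where "\<tau> = inv_into (Field K) \<theta>"
    have \<tau>: "\<theta> (\<tau> v) = v" if "v \<in> Field K" for v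
      unfolding \<tau>_def using that surj by (simp add: f_inv_into_f)
    \<comment> \<open>Since \<open>\<theta>\<close> is injective on vertices and onto the edges of
      \<open>K\<close>, its inverse also preserves edges.\<close>
    have \<tau>K: "(\<tau> u, \<tau> v) \<in> K" if uv: "(u, v) \<in> K" for u v
    proof -
      have "(u, v) \<in> map_prod \<theta> \<theta> ` K" using uv K' by (simp add: K'_def)
      then obtain u' v' where uv': "(u', v') \<in> K" "\<theta> u' = u" "\<theta> v' = v" by auto
      hence "u' \<in> Field K" "v' \<in> Field K" by (auto simp: Field_def)
      hence "\<tau> u = u'" "\<tau> v = v'" using uv' inj by (auto simp: \<tau>_def)
      thus ?thesis using uv' by simp
    qed
    have "hom K (backward \<rho>' H) (g \<circ> \<tau>)"
      using \<tau>K KB g unfolding hom_def comp_apply by blast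
    moreover have "\<forall>v\<in>Field K. \<phi> (\<eta> ((g \<circ> \<tau>) v)) = v" using \<tau> by (simp add: \<theta>_def)
    ultimately show ?thesis by blast
  qed
  hence "inj_on \<rho> {..<h} \<and> K \<subseteq> backward \<rho> H \<and> hom (backward \<rho> H) K \<phi> \<and>
    (\<forall>\<rho>' \<eta>. inj_on \<rho>' {..<h} \<and> hom (backward \<rho>' H) (backward \<rho> H) \<eta> \<longrightarrow>
       (\<exists>\<zeta>. hom K (backward \<rho>' H) \<zeta> \<and> (\<forall>v\<in>Field K. \<phi> (\<eta> (\<zeta> v)) = v)))"
    using \<rho> KB \<phi> by (simp add: B_def I_def)
  thus ?thesis by blast
qed

text \<open>The labels follow the positions on a cycle of the rigid part of the backward edges;
  the summand \<open>w\<close> only serves to make them distinct.\<close>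

lemma exists_labelled_order:
  assumes H: "oriented_graph h H" and n2: "\<not> two_colorable h H"
  shows "\<exists>\<rho> c. inj_on \<rho> {..<h} \<and> inj_on c {..<h} \<and> (\<forall>w<h. c w < h * h) \<and>
    (\<forall>\<rho>' \<eta>. inj_on \<rho>' {..<h} \<and> hom (backward \<rho>' H) (backward \<rho> H) \<eta> \<longrightarrow>
       (\<exists>l z. 3 \<le> l \<and>
          (\<forall>t. Suc t < l \<longrightarrow> (z t, z (Suc t)) \<in> backward \<rho>' H \<union> (backward \<rho>' H)\<inverse>
             \<and> c (\<eta> (z t)) < (c (\<eta> (z (Suc t))) :: nat)) \<and>
          (z 0, z (l - 1)) \<in> backward \<rho>' H \<union> (backward \<rho>' H)\<inverse>))"
proof -
  have HF: "H \<subseteq> {..<h} \<times> {..<h}" and irr: "\<And>u. (u, u) \<notin> H"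
    using H by (auto simp: oriented_graph_def)
  have finH: "finite H" using HF finite_subset by blast
  obtain \<rho> K \<phi> where \<rho>: "inj_on \<rho> {..<h}" and KB: "K \<subseteq> backward \<rho> H" and \<phi>: "hom (backward \<rho> H) K \<phi>"
    and rigid: "\<And>\<rho>' \<eta>. inj_on \<rho>' {..<h} \<Longrightarrow> hom (backward \<rho>' H) (backward \<rho> H) \<eta> \<Longrightarrow>
       \<exists>\<zeta>. hom K (backward \<rho>' H) \<zeta> \<and> (\<forall>v\<in>Field K. \<phi> (\<eta> (\<zeta> v)) = v)"
    using exists_rigid_backward[OF finH, of h] by blast
  have KH: "K \<subseteq> H" using KB backward_subset by blast
  have nbK: "\<not> bipartite K"
    using bipartite_if_hom[OF \<phi>] two_colorable_if_bipartite_back[OF H \<rho>] n2 by blast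
  have "finite K" and irrK: "\<And>u. (u, u) \<notin> K" using KH finH finite_subset irr by blast+
  from exists_cycle_if_not_bipartite[OF this nbK]
  obtain p where dp: "distinct p" and lp: "3 \<le> length p" and pF: "set p \<subseteq> Field K"
    and pe: "\<And>i. Suc i < length p \<Longrightarrow> (p ! i, p ! Suc i) \<in> K \<union> K\<inverse>"
    and pc: "(p ! 0, p ! (length p - 1)) \<in> K \<union> K\<inverse>" by blast
  have "Field K \<subseteq> {..<h}" using KH HF by (auto simp: Field_def)
  hence lph: "length p \<le> h" using dp pF card_mono[of "{..<h}" "set p"] by (simp add: distinct_card)
  \<comment> \<open>The default 0 off the cycle keeps every position below \<open>h\<close>, which
    the bound \<open>h * h\<close> on the labels needs.\<close>
  define pos where "pos v = (if v \<in> set p then inv_into {..<length p} ((!) p) v else 0)" for v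
  have pos: "pos (p ! t) = t" if "t < length p" for t
    using that dp by (auto simp: pos_def inj_on_nth intro!: inv_into_f_f)
  have posl: "pos v < h" if "h > 0" for v
  proof (cases "v \<in> set p")
    case True
    then obtain t where "t < length p" "p ! t = v" by (metis in_set_conv_nth)
    thus ?thesis using pos lph by force
  qed (simp add: pos_def that)
  \<comment> \<open>In base \<open>h\<close> the leading digit of the label is the position on the
    cycle, so comparing positions suffices to compare labels.\<close>
  define c where "c w = pos (\<phi> w) * h + w" for w
  have div: "c w div h = pos (\<phi> w)" and mod: "c w mod h = w" if "w < h" for w
    using that by (auto simp: c_def)
  have "inj_on c {..<h}" by (intro inj_onI) (metis mod lessThan_iff)
  moreover have "\<forall>w<h. c w < h * h"
  proof (intro allI impI)
    fix w assume w: "w < h"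
    have "c w < Suc (pos (\<phi> w)) * h" using w by (simp add: c_def)
    also have "\<dots> \<le> h * h" using posl[of "\<phi> w"] w by (intro mult_right_mono) auto
    finally show "c w < h * h" .
  qed
  moreover have "\<exists>l z. 3 \<le> l \<and>
          (\<forall>t. Suc t < l \<longrightarrow> (z t, z (Suc t)) \<in> backward \<rho>' H \<union> (backward \<rho>' H)\<inverse>
             \<and> c (\<eta> (z t)) < c (\<eta> (z (Suc t)))) \<and>
          (z 0, z (l - 1)) \<in> backward \<rho>' H \<union> (backward \<rho>' H)\<inverse>"
    if \<rho>': "inj_on \<rho>' {..<h}" and \<eta>: "hom (backward \<rho>' H) (backward \<rho> H) \<eta>" for \<rho>' \<eta>
  proof -
    obtain \<zeta> where \<zeta>: "hom K (backward \<rho>' H) \<zeta>" "\<And>v. v \<in> Field K \<Longrightarrow> \<phi> (\<eta> (\<zeta> v)) = v"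
      using rigid[OF \<rho>' \<eta>] by blast
    \<comment> \<open>The cycle of \<open>K\<close> is lifted to the backward edges for
      \<open>\<rho>'\<close>; since \<open>\<phi>\<close> after \<open>\<eta>\<close> sends it back
      to \<open>p\<close>, the leading digit at time \<open>t\<close> is \<open>t\<close>.\<close>
    define z where "z t = \<zeta> (p ! t)" for t
    have e: "(\<zeta> u, \<zeta> v) \<in> backward \<rho>' H \<union> (backward \<rho>' H)\<inverse>" if "(u, v) \<in> K \<union> K\<inverse>" for u v
      using \<zeta>(1) that by (auto simp: hom_def)
    have small: "\<eta> (\<zeta> v) < h" if v: "v \<in> Field K" for v
    proof -
      have "\<eta> (\<zeta> v) \<in> Field H"
        using v \<zeta>(1) \<eta> backward_subset[of \<rho> H] unfolding hom_def Field_def by blast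
      thus ?thesis using HF by (auto simp: Field_def)
    qed
    have "c (\<eta> (z t)) < c (\<eta> (z (Suc t)))" if t: "Suc t < length p" for t
    proof -
      have m: "p ! t \<in> Field K" "p ! Suc t \<in> Field K" using t pF by auto
      have "c (\<eta> (z t)) div h = t" "c (\<eta> (z (Suc t))) div h = Suc t"
        using t m by (simp_all add: z_def div small \<zeta>(2) pos)
      thus ?thesis by (metis div_le_mono lessI not_le)
    qed
    hence "3 \<le> length p \<and> (\<forall>t. Suc t < length p \<longrightarrow> (z t, z (Suc t)) \<in> backward \<rho>' H \<union> (backward \<rho>' H)\<inverse>
             \<and> c (\<eta> (z t)) < c (\<eta> (z (Suc t)))) \<and>
          (z 0, z (length p - 1)) \<in> backward \<rho>' H \<union> (backward \<rho>' H)\<inverse>"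
      using lp e[OF pe] e[OF pc] by (simp add: z_def)
    thus ?thesis by blast
  qed
  ultimately show ?thesis using \<rho> by blast
qed

section \<open>Grids and spheres\<close>

text \<open>The zero tail makes a point determined by its first \<open>d\<close> coordinates: the
  set is finite, and equal points are equal functions.\<close>

definition box :: "nat \<Rightarrow> nat \<Rightarrow> (nat \<Rightarrow> int) set" where
  "box d m = {x. (\<forall>k<d. 0 \<le> x k \<and> x k < int m) \<and> (\<forall>k\<ge>d. x k = 0)}"

definition sphere :: "nat \<Rightarrow> nat \<Rightarrow> int \<Rightarrow> (nat \<Rightarrow> int) set" where
  "sphere d m R = {a \<in> box d m. (\<Sum>k<d. (a k)\<^sup>2) = R}"

lemma box_bij: "bij_betw (\<lambda>x. restrict x {..<d}) (box d m) ({..<d} \<rightarrow>\<^sub>E {0..<int m})"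
proof (rule bij_betw_byWitness[where f' = "\<lambda>x k. if k < d then x k else 0"])
  show "\<forall>x\<in>box d m. (\<lambda>k. if k < d then restrict x {..<d} k else 0) = x"
    by (auto simp: box_def fun_eq_iff)
  show "\<forall>x\<in>{..<d} \<rightarrow>\<^sub>E {0..<int m}. restrict (\<lambda>k. if k < d then x k else 0) {..<d} = x"
    by (auto simp: fun_eq_iff PiE_def extensional_def)
  show "(\<lambda>x. restrict x {..<d}) ` box d m \<subseteq> {..<d} \<rightarrow>\<^sub>E {0..<int m}"
    by (auto simp: box_def split: if_splits)
  show "(\<lambda>x k. if k < d then x k else 0) ` ({..<d} \<rightarrow>\<^sub>E {0..<int m}) \<subseteq> box d m"
    by (rule image_subsetI) (simp add: box_def PiE_iff)
qed

lemma card_box: "card (box d m) = m ^ d"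
  using bij_betw_same_card[OF box_bij[of d m]] by (simp add: card_PiE)

lemma finite_box: "finite (box d m)"
  using bij_betw_finite[OF box_bij[of d m]] by (simp add: finite_PiE)

text \<open>Pigeonhole: the squared norm of a point of the box takes at most
  \<open>d * m\<^sup>2\<close> values.\<close>

lemma exists_large_sphere:
  assumes "d > 0" "m > 0"
  shows "\<exists>R. m ^ d \<le> d * m\<^sup>2 * card (sphere d m R)"
proof (rule ccontr)
  assume "\<not> ?thesis"
  hence small: "d * m\<^sup>2 * card (sphere d m R) \<le> m ^ d - 1" for R
    by (metis Suc_pred' assms(2) less_Suc_eq_le linorder_not_le zero_less_power)
  let ?I = "{0..<int (d * m\<^sup>2)}"
  have "box d m \<subseteq> (\<Union>R\<in>?I. sphere d m R)"
  proof
    fix a assume a: "a \<in> box d m"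
    have "(a k)\<^sup>2 < (int m)\<^sup>2" if "k < d" for k
      using a that by (intro power_strict_mono) (auto simp: box_def)
    hence "(\<Sum>k<d. (a k)\<^sup>2) < (\<Sum>k<d. (int m)\<^sup>2)"
      using assms by (intro sum_strict_mono) auto
    moreover have "0 \<le> (\<Sum>k<d. (a k)\<^sup>2)" by (intro sum_nonneg) simp
    ultimately show "a \<in> (\<Union>R\<in>?I. sphere d m R)"
      using a by (auto simp: sphere_def)
  qed
  moreover have fin: "finite (sphere d m R)" for R
    using finite_box by (simp add: sphere_def)
  ultimately have "card (box d m) \<le> card (\<Union>R\<in>?I. sphere d m R)"
    by (intro card_mono) auto
  also have "\<dots> \<le> (\<Sum>R\<in>?I. card (sphere d m R))" by (rule card_UN_le) simp
  finally have "d * m\<^sup>2 * m ^ d \<le> (\<Sum>R\<in>?I. d * m\<^sup>2 * card (sphere d m R))"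
    by (simp add: card_box flip: sum_distrib_left)
  also have "\<dots> \<le> (\<Sum>R\<in>?I. m ^ d - 1)" using small by (intro sum_mono) simp
  also have "\<dots> = d * m\<^sup>2 * (m ^ d - 1)" by (simp add: nat_mult_distrib nat_power_eq)
  also have "\<dots> < d * m\<^sup>2 * m ^ d" using assms by (intro mult_strict_left_mono) auto
  finally show False by simp
qed

text \<open>A point of a sphere is not a proper convex combination of points of the same sphere.\<close>

lemma sphere_convex_combination:
  assumes b: "b \<in> sphere d m R" and a: "\<And>t. t < l \<Longrightarrow> a t \<in> sphere d m R"
    and pos: "\<And>t. t < l \<Longrightarrow> 0 < (\<mu> t :: int)"
    and eq: "\<And>k. (\<Sum>t<l. \<mu> t * a t k) = (\<Sum>t<l. \<mu> t) * b k"
    and t: "t < (l::nat)"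
  shows "a t = b"
proof -
  have R: "(\<Sum>k<d. (b k)\<^sup>2) = R" "\<And>t. t < l \<Longrightarrow> (\<Sum>k<d. (a t k)\<^sup>2) = R"
    using a b by (auto simp: sphere_def)
  \<comment> \<open>All norms being \<open>R\<close>, expanding the weighted sum of squared
    distances to \<open>b\<close> leaves only inner products with \<open>b\<close>, and the
    hypothesis on the barycentre makes it vanish.\<close>
  have "(\<Sum>t<l. \<mu> t * (\<Sum>k<d. (a t k - b k)\<^sup>2))
      = (\<Sum>t<l. \<mu> t * (2 * R - 2 * (\<Sum>k<d. a t k * b k)))"
    using R by (intro sum.cong)
      (auto simp: power2_diff sum.distrib sum_subtractf sum_distrib_left mult.assoc)
  also have "\<dots> = 2 * R * (\<Sum>t<l. \<mu> t) - 2 * (\<Sum>t<l. \<Sum>k<d. \<mu> t * a t k * b k)"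
    by (simp add: right_diff_distrib sum_subtractf sum_distrib_left mult_ac)
  also have "(\<Sum>t<l. \<Sum>k<d. \<mu> t * a t k * b k) = (\<Sum>k<d. (\<Sum>t<l. \<mu> t * a t k) * b k)"
    by (subst sum.swap) (simp add: sum_distrib_right)
  also have "\<dots> = (\<Sum>t<l. \<mu> t) * R"
    unfolding eq R(1)[symmetric] by (simp add: sum_distrib_left power2_eq_square mult.assoc)
  finally have "(\<Sum>t<l. \<mu> t * (\<Sum>k<d. (a t k - b k)\<^sup>2)) = 0" by simp
  moreover have "0 \<le> \<mu> t * (\<Sum>k<d. (a t k - b k)\<^sup>2)" if "t < l" for t
    using pos[OF that] by (intro mult_nonneg_nonneg sum_nonneg) auto
  ultimately have "\<mu> t * (\<Sum>k<d. (a t k - b k)\<^sup>2) = 0"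
    using t by (subst (asm) sum_nonneg_eq_0_iff) auto
  hence "(\<Sum>k<d. (a t k - b k)\<^sup>2) = 0" using pos[OF t] by simp
  hence "a t k = b k" if "k < d" for k
    using that by (subst (asm) sum_nonneg_eq_0_iff) auto
  moreover have "a t k = b k" if "k \<ge> d" for k
    using that a[OF t] b by (auto simp: sphere_def box_def)
  ultimately show ?thesis by (metis ext not_le)
qed

text \<open>The classes are the residue classes modulo \<open>card X\<close>. Each has
  \<open>n div card X\<close> or one more members below \<open>n\<close>, and \<open>e x\<close>
  lists the guaranteed ones.\<close>

lemma exists_balanced_partition:
  assumes "finite X" "X \<noteq> {}"
  shows "\<exists>cls e. (\<forall>v. cls v \<in> X) \<and> (\<forall>x\<in>X. card {v. v < n \<and> cls v = x} \<le> Suc (n div card X)) \<and>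
    (\<forall>x\<in>X. \<forall>s < n div card X. e x s < n \<and> cls (e x s) = x) \<and>
    (\<forall>x\<in>X. inj_on (e x) {..<n div card X})"
proof -
  define N where "N = card X"
  have N: "N > 0" using assms by (simp add: N_def card_gt_0_iff)
  obtain \<beta> where \<beta>: "bij_betw \<beta> {..<N} X"
    using finite_same_card_bij[of "{..<N}" X] assms by (auto simp: N_def)
  define \<gamma> where "\<gamma> = inv_into {..<N} \<beta>"
  have \<gamma>: "\<gamma> x < N" "\<beta> (\<gamma> x) = x" if "x \<in> X" for x
    using that \<beta> inv_into_into[of x \<beta> "{..<N}"]
    by (auto simp: \<gamma>_def bij_betw_def f_inv_into_f)
  have \<gamma>': "\<gamma> (\<beta> j) = j" if "j < N" for j
    using that \<beta> by (simp add: \<gamma>_def bij_betw_inv_into_left)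
  define cls where "cls v = \<beta> (v mod N)" for v
  define e where "e x s = \<gamma> x + N * s" for x s
  have "cls v \<in> X" for v
    using \<beta> N by (auto simp: cls_def bij_betw_def)
  moreover have "card {v. v < n \<and> cls v = x} \<le> Suc (n div N)" if "x \<in> X" for x
  proof -
    have "{v. v < n \<and> cls v = x} \<subseteq> e x ` {..n div N}"
    proof safe
      fix v assume v: "v < n" "x = cls v"
      have "v = e (cls v) (v div N)" using \<gamma>'[of "v mod N"] N by (simp add: e_def cls_def)
      moreover have "v div N \<le> n div N" using v by (intro div_le_mono) simp
      ultimately show "v \<in> e (cls v) ` {..n div N}" by blast
    qed
    thus ?thesis using surj_card_le[of "{..n div N}" _ "e x"] by simp
  qed
  moreover have "e x s < n \<and> cls (e x s) = x" if "x \<in> X" "s < n div N" for x s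
  proof -
    have "e x s < N * Suc s" using \<gamma>(1)[OF that(1)] by (simp add: e_def)
    also have "\<dots> \<le> N * (n div N)" using that(2) by (intro mult_left_mono) auto
    also have "\<dots> \<le> n" by simp
    finally show ?thesis using \<gamma>[OF that(1)] by (simp add: e_def cls_def)
  qed
  moreover have "inj_on (e x) {..<n div N}" for x
    using N by (auto simp: inj_on_def e_def)
  ultimately show ?thesis unfolding N_def by blast
qed

section \<open>The blown-up construction\<close>

text \<open>\<open>cycle\<close> is the property from \<open>exists_labelled_order\<close>;
  \<open>cls\<close> and \<open>e\<close> come from \<open>exists_balanced_partition\<close>, with
  \<open>q\<close> vertices guaranteed at each point of each part. The side \<open>h * h * r\<close>
  leaves room for all points \<open>x + c(i) a\<close> with \<open>x\<close> and \<open>a\<close> in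
  the box of side \<open>r\<close>.\<close>

locale blowup =
  fixes h :: nat and H :: "(nat \<times> nat) set" and \<rho> c :: "nat \<Rightarrow> nat" and d r :: nat and R :: int
    and n q :: nat and cls :: "nat \<Rightarrow> nat \<times> (nat \<Rightarrow> int)" and e :: "nat \<times> (nat \<Rightarrow> int) \<Rightarrow> nat \<Rightarrow> nat"
  assumes oriented: "oriented_graph h H"
    and h2: "2 \<le> h"
    and \<rho>_inj: "inj_on \<rho> {..<h}" and c_inj: "inj_on c {..<h}" and c_less: "\<And>w. w < h \<Longrightarrow> c w < h * h"
    and cycle: "\<And>\<rho>' \<eta>. inj_on \<rho>' {..<h} \<Longrightarrow> hom (backward \<rho>' H) (backward \<rho> H) \<eta> \<Longrightarrow>
       \<exists>l z. 3 \<le> l \<and>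
          (\<forall>t. Suc t < l \<longrightarrow> (z t, z (Suc t)) \<in> backward \<rho>' H \<union> (backward \<rho>' H)\<inverse>
             \<and> c (\<eta> (z t)) < c (\<eta> (z (Suc t)))) \<and>
          (z 0, z (l - 1)) \<in> backward \<rho>' H \<union> (backward \<rho>' H)\<inverse>"
    and cls_in: "\<And>v. cls v \<in> {..<h} \<times> box d (h * h * r)"
    and cls_card: "\<And>x. x \<in> {..<h} \<times> box d (h * h * r) \<Longrightarrow> card {v. v < n \<and> cls v = x} \<le> Suc q"
    and e: "\<And>x s. x \<in> {..<h} \<times> box d (h * h * r) \<Longrightarrow> s < q \<Longrightarrow> e x s < n \<and> cls (e x s) = x"
    and e_inj: "\<And>x. x \<in> {..<h} \<times> box d (h * h * r) \<Longrightarrow> inj_on (e x) {..<q}"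
begin

definition part :: "nat \<Rightarrow> nat" where "part v = fst (cls v)"

definition point :: "nat \<Rightarrow> nat \<Rightarrow> int" where "point v = snd (cls v)"

definition aligned :: "(nat \<Rightarrow> int) \<Rightarrow> nat \<Rightarrow> nat \<Rightarrow> bool" where
  "aligned a u v \<longleftrightarrow> (\<forall>k. point v k - point u k = (int (c (part v)) - int (c (part u))) * a k)"

text \<open>Only the displacement between the two points is tested, not whether the line starts in
  the box of side \<open>r\<close>. So pairs outside all planted copies may be reversed as well; the
  bound on copies uses only the displacement.\<close>

definition reversed :: "nat \<Rightarrow> nat \<Rightarrow> bool" where
  "reversed u v \<longleftrightarrow> (part u, part v) \<in> backward \<rho> H \<and> (\<exists>a\<in>sphere d r R. aligned a u v)"

text \<open>On vertices below \<open>n\<close> this is the lexicographic order: first the place of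
  the part under \<open>\<rho>\<close>, then the number of the vertex.\<close>

definition rank :: "nat \<Rightarrow> nat" where "rank v = \<rho> (part v) * n + v"

definition T :: "(nat \<times> nat) set" where
  "T = {(u, v). u < n \<and> v < n \<and> (reversed u v \<or> rank u < rank v \<and> \<not> reversed v u)}"

lemma aligned_sym: "aligned a u v \<longleftrightarrow> aligned a v u"
  unfolding aligned_def by (intro all_cong1) (auto simp: algebra_simps)

lemma part_less: "part v < h"
  using cls_in[of v] by (auto simp: part_def mem_Times_iff)

lemma rank_less: "\<rho> (part u) < \<rho> (part v) \<Longrightarrow> u < n \<Longrightarrow> rank u < rank v"
proof -
  assume *: "\<rho> (part u) < \<rho> (part v)" "u < n"
  have "rank u < Suc (\<rho> (part u)) * n" using * by (simp add: rank_def)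
  also have "\<dots> \<le> \<rho> (part v) * n" using * by (intro mult_right_mono) auto
  finally show ?thesis by (simp add: rank_def)
qed

lemma rank_inj: "inj_on rank {..<n}"
proof (rule inj_onI)
  fix u v assume *: "u \<in> {..<n}" "v \<in> {..<n}" "rank u = rank v"
  have "rank u mod n = u" "rank v mod n = v" using *(1,2) by (simp_all add: rank_def)
  thus "u = v" using *(3) by metis
qed

lemma reversed_rank: "reversed u v \<Longrightarrow> v < n \<Longrightarrow> rank v < rank u"
  by (auto simp: reversed_def backward_def intro: rank_less)

text \<open>A reversed pair goes down in rank, so no pair is reversed in both directions; all other
  pairs are directed by the injective rank.\<close>

lemma tournament_T: "tournament n T"
proof -
  have anti: "\<not> (reversed u v \<and> reversed v u)" if "u < n" "v < n" for u v
    using reversed_rank[of u v] reversed_rank[of v u] that by auto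
  have total: "rank u < rank v \<or> rank v < rank u" if "u < n" "v < n" "u \<noteq> v" for u v
    using rank_inj that by (metis inj_on_def lessThan_iff nat_neq_iff)
  have "T \<subseteq> {..<n} \<times> {..<n}" by (auto simp: T_def)
  moreover have "(u, u) \<notin> T" for u using anti[of u u] by (simp add: T_def)
  moreover have "(v, u) \<notin> T" if "(u, v) \<in> T" for u v
    using that anti[of u v] reversed_rank unfolding T_def by fastforce
  moreover have "(u, v) \<in> T \<or> (v, u) \<in> T" if "u < n" "v < n" "u \<noteq> v" for u v
    using total[OF that] that by (simp add: T_def) blast
  ultimately show ?thesis unfolding tournament_def oriented_graph_def by blast
qed

section \<open>Planted copies and the lower bound on reversals\<close>

lemma H_less: "(u, v) \<in> H \<Longrightarrow> u < h \<and> v < h \<and> u \<noteq> v \<and> (v, u) \<notin> H"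
  using oriented by (auto simp: oriented_graph_def)

text \<open>The planted copy with base point \<open>x\<close> and direction \<open>a\<close>;
  \<open>s\<close> selects one of the \<open>q\<close> listed vertices in each class that it
  visits.\<close>

definition emb :: "(nat \<Rightarrow> int) \<Rightarrow> (nat \<Rightarrow> int) \<Rightarrow> (nat \<Rightarrow> nat) \<Rightarrow> nat \<Rightarrow> nat" where
  "emb x a s i = e (i, \<lambda>k. x k + int (c i) * a k) (s i)"

lemma shift_in_box:
  assumes x: "x \<in> box d r" and a: "a \<in> box d r" and i: "i < h"
  shows "(\<lambda>k. x k + int (c i) * a k) \<in> box d (h * h * r)"
proof -
  have "x k + int (c i) * a k < int (h * h * r)" "0 \<le> x k + int (c i) * a k" if k: "k < d" for k
  proof -
    have xk: "0 \<le> x k" "x k < int r" and ak: "0 \<le> a k" "a k < int r"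
      using x a k by (auto simp: box_def)
    have "int (c i) * a k \<le> int (c i) * int r" using ak by (intro mult_left_mono) auto
    hence "x k + int (c i) * a k < int (Suc (c i) * r)" using xk by (simp add: algebra_simps)
    also have "\<dots> \<le> int (h * h * r)"
      unfolding of_nat_le_iff using c_less[OF i] by (intro mult_right_mono) auto
    finally show "x k + int (c i) * a k < int (h * h * r)" .
    show "0 \<le> x k + int (c i) * a k" using xk ak by simp
  qed
  thus ?thesis using x a by (auto simp: box_def)
qed

context
  fixes x a s
  assumes x: "x \<in> box d r" and a: "a \<in> sphere d r R" and s: "s \<in> {..<h} \<rightarrow> {..<q}"
begin

lemma emb:
  assumes "i < h"
  shows "emb x a s i < n" "part (emb x a s i) = i" "point (emb x a s i) k = x k + int (c i) * a k"
proof -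
  have "(i, \<lambda>k. x k + int (c i) * a k) \<in> {..<h} \<times> box d (h * h * r)"
    using shift_in_box[OF x _ assms] a assms by (auto simp: sphere_def)
  moreover have "s i < q" using s assms by auto
  ultimately show "emb x a s i < n" "part (emb x a s i) = i"
    "point (emb x a s i) k = x k + int (c i) * a k"
    using e by (simp_all add: emb_def part_def point_def)
qed

text \<open>Backward edges of \<open>H\<close> become reversed pairs through the direction
  \<open>a\<close>. Forward ones follow the rank, and are not overruled because the opposite pair is
  no edge of \<open>H\<close>.\<close>

lemma emb_edge:
  assumes uv: "(u, v) \<in> H"
  shows "(emb x a s u, emb x a s v) \<in> T"
proof -
  have uvh: "u < h" "v < h" "u \<noteq> v" "(v, u) \<notin> H" using H_less[OF uv] by auto
  have "aligned a (emb x a s u) (emb x a s v)"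
    using uvh by (simp add: aligned_def emb algebra_simps)
  hence 1: "reversed (emb x a s u) (emb x a s v)" if "\<rho> v < \<rho> u"
    using that a uv uvh by (auto simp: reversed_def emb backward_def)
  have 2: "\<not> reversed (emb x a s v) (emb x a s u)"
    using uvh by (auto simp: reversed_def emb backward_def)
  have "\<rho> u \<noteq> \<rho> v" using \<rho>_inj uvh by (auto simp: inj_on_def)
  hence "\<rho> v < \<rho> u \<or> rank (emb x a s u) < rank (emb x a s v)"
    using rank_less[of "emb x a s u" "emb x a s v"] uvh
    by (simp add: emb) linarith
  thus ?thesis using 1 2 uvh by (auto simp: T_def emb)
qed

lemma emb_hits:
  assumes "H_free h H n T'"
  shows "\<exists>u v. (u, v) \<in> H \<and> (emb x a s u, emb x a s v) \<in> T - T'"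
proof (rule ccontr)
  assume "\<not> ?thesis"
  hence "\<forall>(u, v)\<in>H. (emb x a s u, emb x a s v) \<in> T'" using emb_edge by blast
  moreover have "inj_on (emb x a s) {..<h}"
    by (rule inj_onI) (metis emb(2) lessThan_iff)
  moreover have "emb x a s ` {..<h} \<subseteq> {..<n}" using emb(1) by auto
  ultimately have "(emb x a s ` {..<h}, (\<lambda>(u, v). (emb x a s u, emb x a s v)) ` H) \<in> copies h H n T'"
    unfolding copies_def by blast
  thus False using assms by (simp add: H_free_def)
qed

end

text \<open>Edge-disjointness up to the choice of \<open>s\<close>: two points with distinct labels
  on a line determine its direction and base point, and injectivity of \<open>e\<close> recovers
  \<open>s\<close> at both.\<close>

lemma emb_determined:
  assumes x: "x \<in> box d r" "x' \<in> box d r" and a: "a \<in> sphere d r R" "a' \<in> sphere d r R"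
    and s: "s \<in> {..<h} \<rightarrow> {..<q}" "s' \<in> {..<h} \<rightarrow> {..<q}"
    and uv: "u < h" "v < h" "u \<noteq> v"
    and eq: "emb x a s u = emb x' a' s' u" "emb x a s v = emb x' a' s' v"
  shows "x = x' \<and> a = a' \<and> s u = s' u \<and> s v = s' v"
proof -
  have 1: "x k + int (c u) * a k = x' k + int (c u) * a' k" for k
    using eq(1) emb(3)[OF x(1) a(1) s(1) uv(1)] emb(3)[OF x(2) a(2) s(2) uv(1)] by metis
  have 2: "x k + int (c v) * a k = x' k + int (c v) * a' k" for k
    using eq(2) emb(3)[OF x(1) a(1) s(1) uv(2)] emb(3)[OF x(2) a(2) s(2) uv(2)] by metis
  have "c u \<noteq> c v" using c_inj uv by (auto simp: inj_on_def)
  moreover have "(int (c u) - int (c v)) * (a k - a' k) = 0" for k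
    using 1[of k] 2[of k] by (simp add: algebra_simps)
  ultimately have "a k = a' k" for k by (metis eq_iff_diff_eq_0 mult_eq_0_iff of_nat_eq_iff)
  hence a': "a = a'" by auto
  hence x': "x = x'" using 1 by auto
  have "s w = s' w" if w: "w < h" and ew: "emb x a s w = emb x' a' s' w" for w
  proof -
    have "(w, \<lambda>k. x k + int (c w) * a k) \<in> {..<h} \<times> box d (h * h * r)"
      using shift_in_box[OF x(1) _ w] a w by (auto simp: sphere_def)
    from e_inj[OF this] show ?thesis
      using ew s w unfolding emb_def a'[symmetric] x'[symmetric] by (auto simp: inj_on_def)
  qed
  thus ?thesis using a' x' uv eq by auto
qed

text \<open>Double counting: each planted copy loses an edge in \<open>T'\<close>, and a given edge
  lies in at most \<open>q ^ (h - 2)\<close> planted copies, since only the values of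
  \<open>s\<close> off its two ends remain free.\<close>

lemma reversals_ge:
  assumes free: "H_free h H n T'"
  shows "r ^ d * card (sphere d r R) * q\<^sup>2 \<le> card (T - T')"
proof (cases "q = 0")
  case q: False
  define A where "A = box d r \<times> sphere d r R \<times> ({..<h} \<rightarrow>\<^sub>E {..<q})"
  define A' where "A' p = {(x, a, s) \<in> A. \<exists>u v. (u, v) \<in> H \<and> (emb x a s u, emb x a s v) = p}" for p
  have finS: "finite (sphere d r R)" using finite_box by (simp add: sphere_def)
  have finA: "finite A" unfolding A_def using finS finite_box by (intro finite_SigmaI finite_PiE) auto
  have "finite T" by (rule finite_subset[of _ "{..<n} \<times> {..<n}"]) (auto simp: T_def)
  have "A \<subseteq> (\<Union>p\<in>T - T'. A' p)"
  proof safe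
    fix x a s assume xas: "(x, a, s) \<in> A"
    hence "\<exists>u v. (u, v) \<in> H \<and> (emb x a s u, emb x a s v) \<in> T - T'"
      by (intro emb_hits free) (auto simp: A_def PiE_def)
    thus "(x, a, s) \<in> (\<Union>p\<in>T - T'. A' p)" using xas unfolding A'_def by blast
  qed
  moreover have "finite (A' p)" for p
    by (rule finite_subset[OF _ finA]) (auto simp: A'_def)
  ultimately have "card A \<le> card (\<Union>p\<in>T - T'. A' p)"
    using \<open>finite T\<close> by (intro card_mono) auto
  also have "\<dots> \<le> (\<Sum>p\<in>T - T'. card (A' p))" using \<open>finite T\<close> by (intro card_UN_le) simp
  also have "\<dots> \<le> (\<Sum>p\<in>T - T'. q ^ (h - 2))"
  proof (rule sum_mono)
    fix p assume "p \<in> T - T'"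
    obtain p1 p2 where p: "p = (p1, p2)" by force
    \<comment> \<open>The parts of the two ends reveal which edge of \<open>H\<close> is mapped to
      \<open>p\<close>.\<close>
    define u v where "u = part p1" and "v = part p2"
    have A'D: "x \<in> box d r" "a \<in> sphere d r R" "s \<in> {..<h} \<rightarrow> {..<q}"
        "s \<in> extensional {..<h}" "emb x a s u = p1" "emb x a s v = p2" "u \<noteq> v"
      if xas: "(x, a, s) \<in> A' p" for x a s
    proof -
      show *: "x \<in> box d r" "a \<in> sphere d r R" "s \<in> {..<h} \<rightarrow> {..<q}" "s \<in> extensional {..<h}"
        using xas by (auto simp: A'_def A_def PiE_def)
      obtain u' v' where uv': "(u', v') \<in> H" "emb x a s u' = p1" "emb x a s v' = p2"
        using xas p by (auto simp: A'_def)
      have "u = u'" "v = v'"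
        using uv' H_less[OF uv'(1)] emb(2)[OF *(1-3)] by (auto simp: u_def v_def)
      thus "emb x a s u = p1" "emb x a s v = p2" "u \<noteq> v" using uv' H_less[OF uv'(1)] by auto
    qed
    have uvh: "u < h" "v < h" by (auto simp: u_def v_def part_less)
    show "card (A' p) \<le> q ^ (h - 2)"
    proof (cases "A' p = {}")
      case False
      hence "u \<noteq> v" using A'D(7) by auto
      let ?g = "\<lambda>(x :: nat \<Rightarrow> int, a :: nat \<Rightarrow> int, s :: nat \<Rightarrow> nat). restrict s ({..<h} - {u, v})"
      have "card (A' p) \<le> card (({..<h} - {u, v}) \<rightarrow>\<^sub>E {..<q})"
      proof (rule card_inj_on_le[of ?g])
        show "?g ` A' p \<subseteq> ({..<h} - {u, v}) \<rightarrow>\<^sub>E {..<q}"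
        proof (rule image_subsetI, clarify)
          fix x a s assume "(x, a, s) \<in> A' p"
          hence "s i < q" if "i < h" for i using A'D(3) that by blast
          thus "restrict s ({..<h} - {u, v}) \<in> ({..<h} - {u, v}) \<rightarrow>\<^sub>E {..<q}"
            by (intro restrict_PiE_iff[THEN iffD2]) auto
        qed
        show "finite (({..<h} - {u, v}) \<rightarrow>\<^sub>E {..<q})" by (intro finite_PiE) auto
        show "inj_on ?g (A' p)"
        proof (rule inj_onI)
          fix y y' assume "y \<in> A' p" "y' \<in> A' p" "?g y = ?g y'"
          moreover obtain x a s x' a' s' where y: "y = (x, a, s)" "y' = (x', a', s')"
            by (metis surj_pair)
          ultimately have m: "(x, a, s) \<in> A' p" "(x', a', s') \<in> A' p"
            and r: "restrict s ({..<h} - {u, v}) = restrict s' ({..<h} - {u, v})" by auto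
          note D = A'D[OF m(1)] and D' = A'D[OF m(2)]
          have *: "x = x' \<and> a = a' \<and> s u = s' u \<and> s v = s' v"
            by (rule emb_determined[OF D(1) D'(1) D(2) D'(2) D(3) D'(3) uvh \<open>u \<noteq> v\<close>])
               (simp_all add: D D')
          have "s w = s' w" if "w < h" for w
          proof (cases "w = u \<or> w = v")
            case False
            hence "restrict s ({..<h} - {u, v}) w = s w" "restrict s' ({..<h} - {u, v}) w = s' w"
              using that by auto
            thus ?thesis using r by simp
          qed (use * in auto)
          hence "s = s'" using D(4) D'(4) by (intro extensionalityI) auto
          thus "y = y'" using * y by auto
        qed
      qed
      also have "\<dots> = q ^ card ({..<h} - {u, v})" by (simp add: card_PiE)
      also have "card ({..<h} - {u, v}) = h - 2"
        using uvh \<open>u \<noteq> v\<close> by (subst card_Diff_subset) auto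
      finally show ?thesis .
    qed simp
  qed
  finally have "r ^ d * card (sphere d r R) * q ^ h \<le> card (T - T') * q ^ (h - 2)"
    by (simp add: A_def card_cartesian_product card_box card_PiE mult.assoc)
  moreover have "q ^ h = q\<^sup>2 * q ^ (h - 2)" using h2 by (metis le_add_diff_inverse power_add)
  ultimately have "(r ^ d * card (sphere d r R) * q\<^sup>2) * q ^ (h - 2) \<le> card (T - T') * q ^ (h - 2)"
    by (simp add: mult.assoc)
  thus ?thesis using q by simp
qed simp

section \<open>Collinear triples and the upper bound on copies\<close>

text \<open>The point of \<open>w\<close> is where the line through \<open>u\<close> and
  \<open>v\<close>, parametrized by labels, arrives at the label of \<open>w\<close>; the
  denominator is cleared to stay in the integers.\<close>

definition collinear :: "nat \<Rightarrow> nat \<Rightarrow> nat \<Rightarrow> bool" where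
  "collinear u v w \<longleftrightarrow> c (part u) < c (part v) \<and>
     (\<forall>k. (int (c (part v)) - int (c (part u))) * (point w k - point v k)
        = (int (c (part w)) - int (c (part v))) * (point v k - point u k))"

text \<open>The copy inherits an order from the rank, and \<open>cycle\<close> yields a cycle of
  reversed pairs with increasing labels. Its steps are positive multiples of sphere points, and
  their sum is a multiple of one sphere point by the closing edge. Convexity makes all directions
  equal, so the first three vertices lie on one line.\<close>

lemma copy_has_collinear:
  assumes inj: "inj_on f {..<h}" and fn: "\<And>i. i < h \<Longrightarrow> f i < n"
    and fT: "\<And>u v. (u, v) \<in> H \<Longrightarrow> (f u, f v) \<in> T"
  shows "\<exists>u<h. \<exists>v<h. \<exists>w<h. u \<noteq> w \<and> v \<noteq> w \<and> collinear (f u) (f v) (f w)"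
proof -
  define \<rho>' where "\<rho>' = rank \<circ> f"
  define \<eta> where "\<eta> = part \<circ> f"
  have "inj_on \<rho>' {..<h}" unfolding \<rho>'_def
    using fn by (intro comp_inj_on inj inj_on_subset[OF rank_inj]) auto
  \<comment> \<open>An edge of \<open>T\<close> that goes down in rank can only come from the
    reversed pairs.\<close>
  have rev: "reversed (f u) (f v)" if "(u, v) \<in> backward \<rho>' H" for u v
    using that fT[of u v] by (auto simp: backward_def \<rho>'_def T_def)
  hence "hom (backward \<rho>' H) (backward \<rho> H) \<eta>"
    by (simp add: hom_def \<eta>_def reversed_def)
  from cycle[OF \<open>inj_on \<rho>' {..<h}\<close> this]
  obtain l z where l: "3 \<le> l"
    and adj: "\<And>t. Suc t < l \<Longrightarrow> (z t, z (Suc t)) \<in> backward \<rho>' H \<union> (backward \<rho>' H)\<inverse>"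
    and mono: "\<And>t. Suc t < l \<Longrightarrow> c (\<eta> (z t)) < c (\<eta> (z (Suc t)))"
    and closing: "(z 0, z (l - 1)) \<in> backward \<rho>' H \<union> (backward \<rho>' H)\<inverse>"
    by blast
  have al: "\<exists>a\<in>sphere d r R. aligned a (f u) (f v)"
    if "(u, v) \<in> backward \<rho>' H \<union> (backward \<rho>' H)\<inverse>" for u v
    using that rev aligned_sym unfolding reversed_def by blast
  have "\<forall>t. \<exists>a. Suc t < l \<longrightarrow> a \<in> sphere d r R \<and> aligned a (f (z t)) (f (z (Suc t)))"
    using al[OF adj] by blast
  then obtain a where a: "\<And>t. Suc t < l \<Longrightarrow> a t \<in> sphere d r R"
    and aal: "\<And>t. Suc t < l \<Longrightarrow> aligned (a t) (f (z t)) (f (z (Suc t)))" by metis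
  obtain b where b: "b \<in> sphere d r R" and bal: "aligned b (f (z 0)) (f (z (l - 1)))"
    using al[OF closing] by blast
  define C where "C t = int (c (\<eta> (z t)))" for t
  define y where "y t = point (f (z t))" for t
  have step: "y (Suc t) k - y t k = (C (Suc t) - C t) * a t k" if "Suc t < l" for t k
    using aal[OF that] by (simp add: aligned_def y_def C_def \<eta>_def)
  have last: "y (l - 1) k - y 0 k = (C (l - 1) - C 0) * b k" for k
    using bal by (simp add: aligned_def y_def C_def \<eta>_def)
  \<comment> \<open>The weights are the label increments, which telescope to the label difference
    across the closing edge.\<close>
  have ab: "a t = b" if "t < l - 1" for t
  proof (rule sphere_convex_combination[OF b, where l = "l - 1" and \<mu> = "\<lambda>t. C (Suc t) - C t"])
    fix k
    have "(\<Sum>t<l - 1. (C (Suc t) - C t) * a t k) = (\<Sum>t<l - 1. y (Suc t) k - y t k)"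
      using step by (intro sum.cong) auto
    also have "\<dots> = y (l - 1) k - y 0 k" by (rule sum_lessThan_telescope)
    also have "\<dots> = (C (l - 1) - C 0) * b k" by (rule last)
    finally show "(\<Sum>t<l - 1. (C (Suc t) - C t) * a t k) = (\<Sum>t<l - 1. C (Suc t) - C t) * b k"
      by (simp only: sum_lessThan_telescope)
  qed (use that a mono in \<open>auto simp: C_def\<close>)
  have e01: "y 1 k - y 0 k = (C 1 - C 0) * b k" and e12: "y 2 k - y 1 k = (C 2 - C 1) * b k" for k
    using step[of 0 k] step[of 1 k] ab[of 0] ab[of 1] l by (simp_all add: numeral_2_eq_2)
  have C: "C 0 < C 1" "C 1 < C 2" using mono[of 0] mono[of 1] l by (simp_all add: C_def numeral_2_eq_2)
  have zF: "z t < h" if "Suc t < l" for t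
    using adj[OF that] H_less backward_subset[of \<rho>' H] by blast
  have "(z 2 :: nat) < h"
    using adj[of 1] l H_less backward_subset[of \<rho>' H] by (simp add: numeral_2_eq_2) blast
  moreover have "z 0 < h" "z 1 < h" using zF[of 0] zF[of 1] l by auto
  moreover have "z 0 \<noteq> z 2" "z 1 \<noteq> z 2" using C by (auto simp: C_def)
  moreover have "collinear (f (z 0)) (f (z 1)) (f (z 2))"
    using C e01 e12 by (simp add: collinear_def y_def C_def \<eta>_def)
  ultimately show ?thesis by blast
qed

text \<open>Once \<open>u\<close> and \<open>v\<close> are fixed, the part of \<open>w\<close>
  determines its point, leaving at most \<open>h\<close> classes.\<close>

lemma card_collinear_le: "card {w. w < n \<and> collinear u v w} \<le> h * Suc q"
proof -
  \<comment> \<open>The division is exact whenever some \<open>w\<close> of part \<open>i\<close> is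
    collinear with \<open>u\<close> and \<open>v\<close>; otherwise its value is irrelevant.\<close>
  define Y where "Y i k = point v k
    + (int (c i) - int (c (part v))) * (point v k - point u k) div (int (c (part v)) - int (c (part u)))"
    for i k
  have "{w. w < n \<and> collinear u v w} \<subseteq> (\<Union>i<h. {w. w < n \<and> cls w = (i, Y i)})"
  proof safe
    fix w assume w: "w < n" "collinear u v w"
    have "point w k = Y (part w) k" for k
    proof -
      have "(int (c (part w)) - int (c (part v))) * (point v k - point u k)
         = (int (c (part v)) - int (c (part u))) * (point w k - point v k)"
        and "int (c (part v)) - int (c (part u)) \<noteq> 0"
        using w by (auto simp: collinear_def)
      thus ?thesis unfolding Y_def by simp
    qed
    hence "cls w = (part w, Y (part w))"
      by (auto simp: part_def point_def prod_eq_iff fun_eq_iff)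
    thus "w \<in> (\<Union>i<h. {w. w < n \<and> cls w = (i, Y i)})" using w part_less by blast
  qed
  hence "card {w. w < n \<and> collinear u v w} \<le> card (\<Union>i<h. {w. w < n \<and> cls w = (i, Y i)})"
    by (intro card_mono) auto
  also have "\<dots> \<le> (\<Sum>i<h. card {w. w < n \<and> cls w = (i, Y i)})" by (rule card_UN_le) simp
  also have "\<dots> \<le> (\<Sum>i<h. Suc q)"
  proof (rule sum_mono)
    fix i
    show "card {w. w < n \<and> cls w = (i, Y i)} \<le> Suc q"
    \<comment> \<open>The extrapolated point may leave the box; then its class is empty.\<close>
    proof (cases "(i, Y i) \<in> {..<h} \<times> box d (h * h * r)")
      case False
      hence "{w. w < n \<and> cls w = (i, Y i)} = {}" using cls_in by (metis (mono_tags, lifting) Collect_empty_eq)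
      thus ?thesis by (simp only: card.empty)
    qed (rule cls_card)
  qed
  finally show ?thesis by simp
qed

text \<open>Choose the map off \<open>w\<close> freely. This fixes the images of \<open>u\<close>
  and \<open>v\<close>, as both differ from \<open>w\<close>, and \<open>card_collinear_le\<close>
  bounds the choices for the image of \<open>w\<close>.\<close>

lemma card_maps_collinear_le:
  assumes "u < h" "v < h" "w < h" "u \<noteq> w" "v \<noteq> w"
  shows "card {f \<in> {..<h} \<rightarrow>\<^sub>E {..<n}. collinear (f u) (f v) (f w)} \<le> n ^ (h - 1) * (h * Suc q)"
proof -
  let ?P = "({..<h} - {w}) \<rightarrow>\<^sub>E {..<n}"
  let ?L = "\<lambda>g. {p. p < n \<and> collinear (g u) (g v) p}"
  let ?F = "{f \<in> {..<h} \<rightarrow>\<^sub>E {..<n}. collinear (f u) (f v) (f w)}"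
  have finP: "finite ?P" by (intro finite_PiE) auto
  have "card ?F \<le> card (SIGMA g:?P. ?L g)"
  proof (rule card_inj_on_le[of "\<lambda>f. (restrict f ({..<h} - {w}), f w)"])
    show "inj_on (\<lambda>f. (restrict f ({..<h} - {w}), f w)) ?F"
    proof (rule inj_onI)
      fix f g assume f: "f \<in> ?F" and g: "g \<in> ?F"
        and eq: "(restrict f ({..<h} - {w}), f w) = (restrict g ({..<h} - {w}), g w)"
      have "f i = g i" if "i < h" for i
      proof (cases "i = w")
        case False
        have "restrict f ({..<h} - {w}) i = restrict g ({..<h} - {w}) i" using eq by simp
        thus ?thesis using False that by simp
      qed (use eq in simp)
      thus "f = g" using f g by (intro extensionalityI[of f "{..<h}" g]) (auto simp: PiE_def)
    qed
    show "(\<lambda>f. (restrict f ({..<h} - {w}), f w)) ` ?F \<subseteq> (SIGMA g:?P. ?L g)"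
      using assms by (auto simp: PiE_def)
    show "finite (SIGMA g:?P. ?L g)" using finP by (intro finite_SigmaI) auto
  qed
  also have "\<dots> = (\<Sum>g\<in>?P. card (?L g))" using finP by (intro card_SigmaI) auto
  also have "\<dots> \<le> (\<Sum>g\<in>?P. h * Suc q)" by (intro sum_mono card_collinear_le)
  also have "\<dots> = n ^ (h - 1) * (h * Suc q)" using assms(3) by (simp add: card_PiE)
  finally show ?thesis .
qed

lemma card_copies_le: "card (copies h H n T) \<le> h ^ 3 * (n ^ (h - 1) * (h * Suc q))"
proof -
  define W where "W = {..<h} \<times> {..<h} \<times> {..<h}"
  define F where "F = (\<lambda>(u, v, w). {f \<in> {..<h} \<rightarrow>\<^sub>E {..<n}. u \<noteq> w \<and> v \<noteq> w \<and> collinear (f u) (f v) (f w)})"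
  have finW: "finite W" by (simp add: W_def)
  have finF: "finite (\<Union>t\<in>W. F t)"
    by (rule finite_subset[of _ "{..<h} \<rightarrow>\<^sub>E {..<n}"]) (auto simp: F_def intro!: finite_PiE)
  let ?g = "\<lambda>f :: nat \<Rightarrow> nat. (f ` {..<h}, (\<lambda>(u, v). (f u, f v)) ` H)"
  have "copies h H n T \<subseteq> ?g ` (\<Union>t\<in>W. F t)"
  proof
    fix X assume "X \<in> copies h H n T"
    then obtain f where f: "X = ?g f" "inj_on f {..<h}" "f ` {..<h} \<subseteq> {..<n}"
      "\<forall>(u, v)\<in>H. (f u, f v) \<in> T" unfolding copies_def by blast
    \<comment> \<open>Restriction does not change the copy and makes the map a member of the finite
      function space being counted.\<close>
    let ?f = "restrict f {..<h}"
    have "(\<lambda>(u, v). (f u, f v)) ` H = (\<lambda>(u, v). (?f u, ?f v)) ` H"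
      using H_less by (intro image_cong) auto
    hence X: "X = ?g ?f" using f by simp
    have "\<exists>u<h. \<exists>v<h. \<exists>w<h. u \<noteq> w \<and> v \<noteq> w \<and> collinear (f u) (f v) (f w)"
      using f by (intro copy_has_collinear) auto
    then obtain u v w where uvw: "u < h" "v < h" "w < h" "u \<noteq> w" "v \<noteq> w"
      "collinear (f u) (f v) (f w)" by blast
    hence "?f \<in> F (u, v, w)" using f(3) by (auto simp: F_def)
    moreover have "(u, v, w) \<in> W" using uvw by (simp add: W_def)
    ultimately show "X \<in> ?g ` (\<Union>t\<in>W. F t)" using X by blast
  qed
  hence "card (copies h H n T) \<le> card (\<Union>t\<in>W. F t)" using finF by (rule surj_card_le[rotated])
  also have "\<dots> \<le> (\<Sum>t\<in>W. card (F t))" by (rule card_UN_le[OF finW])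
  also have "\<dots> \<le> (\<Sum>t\<in>W. n ^ (h - 1) * (h * Suc q))"
  proof (rule sum_mono)
    fix t assume "t \<in> W"
    then obtain u v w where t: "t = (u, v, w)" "u < h" "v < h" "w < h" by (auto simp: W_def)
    show "card (F t) \<le> n ^ (h - 1) * (h * Suc q)"
    proof (cases "u \<noteq> w \<and> v \<noteq> w")
      case True
      thus ?thesis using card_maps_collinear_le[of u v w] t by (simp add: F_def)
    qed (auto simp: F_def t)
  qed
  also have "\<dots> = h ^ 3 * (n ^ (h - 1) * (h * Suc q))"
    by (simp add: W_def card_cartesian_product power3_eq_cube mult.assoc)
  finally show ?thesis .
qed

end

section \<open>Choice of parameters\<close>

lemma two_colorable_small:
  assumes "oriented_graph h H" "h < 3"
  shows "two_colorable h H"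
proof -
  have "induced H ({..<h} \<inter> {v}) = {}" for v
    using assms(1) by (auto simp: induced_def oriented_graph_def)
  hence "acyclic (induced H ({..<h} \<inter> {v}))" for v
    by (simp add: acyclic_def)
  moreover have "({..<h} \<inter> {0}) \<union> ({..<h} \<inter> {1}) = {..<h}" "({..<h} \<inter> {0}) \<inter> ({..<h} \<inter> {1}) = {}"
    using assms(2) by auto
  ultimately show ?thesis unfolding two_colorable_def by blast
qed

text \<open>The integer form of the theorem: with \<open>r = h ^ d\<close> there are
  \<open>N = h ^ (2 * d + 1) * r ^ d\<close> classes of about \<open>n / N\<close> vertices. The
  distance loses only a factor exponential in \<open>d\<close>, while collinearity saves about
  \<open>1 / N\<close>, hence \<open>r ^ d = h ^ (d * d)\<close>.\<close>

lemma exists_tournament: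
  assumes H: "oriented_graph h H" "\<not> two_colorable h H" and d: "2 \<le> d"
    and n: "n \<ge> h * (h * h * h ^ d) ^ d"
  shows "\<exists>T. tournament n T \<and>
    (\<forall>T'. H_free h H n T' \<longrightarrow> n\<^sup>2 \<le> h ^ (9 * d) * card (T - T')) \<and>
    h ^ (d * d) * card (copies h H n T) \<le> n ^ h"
proof -
  have h3: "3 \<le> h" using two_colorable_small H by (meson not_le)
  define r where "r = h ^ d"
  have r: "r > 0" using h3 by (simp add: r_def)
  obtain R where R: "r ^ d \<le> d * r\<^sup>2 * card (sphere d r R)"
    using exists_large_sphere[of d r] d r by auto
  define X where "X = {..<h} \<times> box d (h * h * r)"
  define N where "N = card X"
  have N_eq: "N = h * (h * h * r) ^ d"
    by (simp add: N_def X_def card_cartesian_product card_box)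
  have N: "N > 0" using h3 r by (simp add: N_eq)
  have N_eq': "N = h ^ (2 * d + 1) * r ^ d"
    by (simp add: N_eq power_add power_mult power_mult_distrib power2_eq_square)
  have "finite X" "X \<noteq> {}" using N by (auto simp: N_def card_gt_0_iff)
  define q where "q = n div N"
  have nN: "N \<le> n" using n by (simp add: N_eq r_def)
  have q: "q \<ge> 1" using nN N by (simp add: q_def Suc_le_eq div_greater_zero_iff)
  have qN: "q * N \<le> n" by (simp add: q_def)
  \<comment> \<open>As \<open>q\<close> is at least 1, rounding in \<open>n div N\<close> costs at
    most a factor 2.\<close>
  have "n < Suc q * N" using N by (simp add: q_def dividend_less_div_times)
  also have "\<dots> \<le> 2 * q * N" using q by (intro mult_right_mono) auto
  finally have n_le: "n \<le> 2 * q * N" by simp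
  obtain cls e where ce: "\<forall>v. cls v \<in> X" "\<forall>x\<in>X. card {v. v < n \<and> cls v = x} \<le> Suc q"
      "\<forall>x\<in>X. \<forall>s<q. e x s < n \<and> cls (e x s) = x" "\<forall>x\<in>X. inj_on (e x) {..<q}"
    using exists_balanced_partition[OF \<open>finite X\<close> \<open>X \<noteq> {}\<close>, of n, folded N_def, folded q_def]
    by (elim exE conjE)
  obtain \<rho> c where \<rho>c: "inj_on \<rho> {..<h}" "inj_on c {..<h}" "\<And>w. w < h \<Longrightarrow> c w < h * h"
    "\<And>\<rho>' \<eta>. inj_on \<rho>' {..<h} \<Longrightarrow> hom (backward \<rho>' H) (backward \<rho> H) \<eta> \<Longrightarrow>
       \<exists>l z. 3 \<le> l \<and>
          (\<forall>t. Suc t < l \<longrightarrow> (z t, z (Suc t)) \<in> backward \<rho>' H \<union> (backward \<rho>' H)\<inverse>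
             \<and> c (\<eta> (z t)) < (c (\<eta> (z (Suc t))) :: nat)) \<and>
          (z 0, z (l - 1)) \<in> backward \<rho>' H \<union> (backward \<rho>' H)\<inverse>"
    using exists_labelled_order[OF H] by blast
  interpret blowup h H \<rho> c d r R n q cls e
    using H(1) h3 \<rho>c ce by unfold_locales (simp_all only: X_def[symmetric])
  have "n\<^sup>2 \<le> h ^ (9 * d) * card (T - T')" if "H_free h H n T'" for T'
  proof -
    have "2 ^ d \<le> h ^ d" using h3 by (intro power_mono) auto
    hence "d \<le> h ^ d" using less_exp[of d] by linarith
    moreover have "4 \<le> h\<^sup>2" using power_mono[of 2 h 2] h3 by simp
    \<comment> \<open>The exponent is \<open>7 * d + 4\<close>, which is at most
      \<open>9 * d\<close> because \<open>d\<close> is at least 2.\<close>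
    ultimately have "4 * d * h ^ (6 * d + 2) \<le> h\<^sup>2 * h ^ d * h ^ (6 * d + 2)"
      by (intro mult_right_mono mult_mono) auto
    also have "\<dots> = h ^ (2 + d + (6 * d + 2))" by (simp only: power_add)
    also have "\<dots> \<le> h ^ (9 * d)" using d h3 by (intro power_increasing) auto
    finally have *: "4 * d * h ^ (6 * d + 2) \<le> h ^ (9 * d)" .
    have "(2 * d + 1) * 2 = 4 * d + 2" by simp
    hence sq: "(h ^ (2 * d + 1))\<^sup>2 = h ^ (4 * d + 2)" by (metis power_mult)
    have "n\<^sup>2 \<le> (2 * q * N)\<^sup>2" using n_le by (intro power_mono) auto
    also have "\<dots> = 4 * q\<^sup>2 * h ^ (4 * d + 2) * r ^ d * r ^ d"
      unfolding sq[symmetric] N_eq' by (simp add: power2_eq_square)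
    \<comment> \<open>Only one factor \<open>r ^ d\<close> is traded for the sphere; the other
      counts the base points.\<close>
    also have "\<dots> \<le> 4 * q\<^sup>2 * h ^ (4 * d + 2) * r ^ d * (d * r\<^sup>2 * card (sphere d r R))"
      using R by (intro mult_left_mono) auto
    also have "\<dots> = (4 * d * h ^ (6 * d + 2)) * (r ^ d * card (sphere d r R) * q\<^sup>2)"
    proof -
      have "h ^ (6 * d + 2) = h ^ (4 * d + 2) * r\<^sup>2"
        by (simp add: r_def flip: power_add power_mult)
      thus ?thesis by (simp only: mult_ac)
    qed
    also have "\<dots> \<le> h ^ (9 * d) * card (T - T')"
      by (intro mult_mono * reversals_ge that) auto
    finally show ?thesis .
  qed
  moreover have "h ^ (d * d) * card (copies h H n T) \<le> n ^ h"
  proof -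
    \<comment> \<open>The factor \<open>2 * h ^ 4\<close> collects the \<open>h ^ 3\<close> triples,
      the \<open>h\<close> parts for the third vertex and \<open>Suc q\<close> being at most
      \<open>2 * q\<close>; it is absorbed by the factor \<open>h ^ (2 * d + 1)\<close> of
      \<open>N\<close>.\<close>
    have "2 * h ^ 4 \<le> h * h ^ 4" using h3 by (intro mult_right_mono) auto
    also have "\<dots> = h ^ 5" by (simp flip: power_Suc)
    also have "\<dots> \<le> h ^ (2 * d + 1)" using d h3 by (intro power_increasing) auto
    finally have *: "2 * h ^ 4 \<le> h ^ (2 * d + 1)" .
    have "h ^ (d * d) * card (copies h H n T) \<le> r ^ d * (h ^ 3 * (n ^ (h - 1) * (h * Suc q)))"
      by (intro mult_mono card_copies_le) (auto simp: r_def power_mult)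
    also have "\<dots> = h ^ 4 * r ^ d * n ^ (h - 1) * Suc q"
      by (simp add: numeral_eq_Suc algebra_simps)
    also have "\<dots> \<le> h ^ 4 * r ^ d * n ^ (h - 1) * (2 * q)" using q by (intro mult_left_mono) auto
    also have "\<dots> = (2 * h ^ 4) * (r ^ d * n ^ (h - 1) * q)" by simp
    also have "\<dots> \<le> h ^ (2 * d + 1) * (r ^ d * n ^ (h - 1) * q)" using * by (rule mult_right_mono) simp
    also have "\<dots> = n ^ (h - 1) * (q * N)" by (simp add: N_eq')
    also have "\<dots> \<le> n ^ (h - 1) * n" using qN by (intro mult_left_mono) auto
    also have "\<dots> = n ^ h" using h3 by (simp flip: power_Suc2)
    finally show ?thesis .
  qed
  ultimately show ?thesis using tournament_T by blast
qed

theorem theorem4p1: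
  fixes h :: nat
  assumes "h > 0"
  shows "\<exists>\<epsilon>0 > 0. \<exists>\<alpha> > (0::real).
    \<forall>H. oriented_graph h H \<and> \<not> two_colorable h H \<longrightarrow>
      (\<forall>\<epsilon>. 0 < \<epsilon> \<and> \<epsilon> < \<epsilon>0 \<longrightarrow>
        (\<exists>n0. \<forall>n \<ge> n0. \<exists>T. tournament n T \<and> far_from_free \<epsilon> h H n T
            \<and> real (card (copies h H n T)) \<le> \<epsilon> powr (\<alpha> * ln (1 / \<epsilon>)) * real n ^ h))"
proof (cases "h < 3")
  case True
  hence "two_colorable h H" if "oriented_graph h H" for H
    using two_colorable_small that by blast
  thus ?thesis by (meson zero_less_one)
next
  case False
  define b where "b = ln (real h)"
  have b: "b > 0" using False by (simp add: b_def)
  have hb: "real h ^ k = exp (real k * b)" for k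
    using False by (simp add: b_def exp_of_nat_mult)
  have main: "\<exists>n0. \<forall>n \<ge> n0. \<exists>T. tournament n T \<and> far_from_free \<epsilon> h H n T
      \<and> real (card (copies h H n T)) \<le> \<epsilon> powr (1 / (324 * b) * ln (1 / \<epsilon>)) * real n ^ h"
    if H: "oriented_graph h H" "\<not> two_colorable h H" and \<epsilon>: "0 < \<epsilon>" "\<epsilon> < exp (- (18 * b))" for H \<epsilon>
  proof -
    define L where "L = ln (1 / \<epsilon>)"
    have \<epsilon>L: "\<epsilon> = exp (- L)" using \<epsilon> by (simp add: L_def ln_div)
    hence L: "L > 18 * b" using \<epsilon>(2) by simp
    \<comment> \<open>The largest \<open>d\<close> with \<open>\<epsilon> * h ^ (9 * d)\<close> at
      most 1; the bound \<open>exp (- (18 * b))\<close> on \<open>\<epsilon>\<close> ensures that it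
      is at least 2.\<close>
    define d where "d = nat \<lfloor>L / (9 * b)\<rfloor>"
    have "2 \<le> L / (9 * b)" using L b by (simp add: field_simps)
    hence d2: "2 \<le> d" by (simp add: d_def le_nat_iff le_floor_iff)
    have "real d \<le> L / (9 * b)" using L b by (simp add: d_def)
    hence dL: "real (9 * d) * b \<le> L" using b by (simp add: field_simps)
    have "L / (9 * b) < real d + 1" using L b by (simp add: d_def)
    also have "\<dots> \<le> 2 * real d" using d2 by simp
    finally have Ld: "L < 18 * b * real d" using b by (simp add: field_simps)
    have "\<epsilon> * real h ^ (9 * d) = exp (real (9 * d) * b - L)"
      unfolding hb \<epsilon>L by (simp flip: exp_add)
    hence \<epsilon>h: "\<epsilon> * real h ^ (9 * d) \<le> 1" using dL by simp
    \<comment> \<open>Here 324 is the square of 18: from \<open>L < 18 * b * d\<close> follows that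
      \<open>L\<^sup>2 / (324 * b)\<close> is at most \<open>d * d * b\<close>, the logarithm of the
      saving \<open>h ^ (d * d)\<close>.\<close>
    have "L\<^sup>2 \<le> (18 * b * real d)\<^sup>2" using L b Ld by (intro power_mono) auto
    hence "1 / (324 * b) * L * L \<le> real (d * d) * b"
      using b by (simp add: field_simps power2_eq_square)
    hence "exp (- (real (d * d) * b)) \<le> exp (- (1 / (324 * b) * L * L))" by simp
    also have "\<dots> = \<epsilon> powr (1 / (324 * b) * L)"
      using \<epsilon> by (simp add: powr_def \<epsilon>L)
    finally have dens: "1 \<le> \<epsilon> powr (1 / (324 * b) * L) * real h ^ (d * d)"
      unfolding hb by (simp add: exp_minus field_simps)
    have "\<exists>T. tournament n T \<and> far_from_free \<epsilon> h H n T
      \<and> real (card (copies h H n T)) \<le> \<epsilon> powr (1 / (324 * b) * L) * real n ^ h"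
      if n: "n \<ge> h * (h * h * h ^ d) ^ d" for n
    proof -
      obtain T where T: "tournament n T"
        "\<And>T'. H_free h H n T' \<Longrightarrow> n\<^sup>2 \<le> h ^ (9 * d) * card (T - T')"
        "h ^ (d * d) * card (copies h H n T) \<le> n ^ h"
        using exists_tournament[OF H d2 n] by blast
      have "\<epsilon> * real n ^ 2 \<le> real (card (T - T'))" if "H_free h H n T'" for T'
      proof -
        have "real n ^ 2 \<le> real h ^ (9 * d) * real (card (T - T'))"
          using T(2)[OF that] by (metis of_nat_le_iff of_nat_mult of_nat_power)
        hence "\<epsilon> * real n ^ 2 \<le> \<epsilon> * real h ^ (9 * d) * real (card (T - T'))"
          using \<epsilon> by (simp add: mult.assoc)
        also have "\<dots> \<le> 1 * real (card (T - T'))" using \<epsilon>h by (intro mult_right_mono) auto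
        finally show ?thesis by simp
      qed
      hence "far_from_free \<epsilon> h H n T" by (simp add: far_from_free_def reversals_def)
      moreover have "real (card (copies h H n T)) \<le> \<epsilon> powr (1 / (324 * b) * L) * real n ^ h"
      proof -
        have "1 * real (card (copies h H n T))
            \<le> \<epsilon> powr (1 / (324 * b) * L) * real h ^ (d * d) * real (card (copies h H n T))"
          using dens by (intro mult_right_mono) auto
        also have "\<dots> = \<epsilon> powr (1 / (324 * b) * L) * real (h ^ (d * d) * card (copies h H n T))"
          by simp
        also have "\<dots> \<le> \<epsilon> powr (1 / (324 * b) * L) * real (n ^ h)"
          using T(3) by (intro mult_left_mono) (auto simp only: of_nat_le_iff powr_ge_zero)
        finally show ?thesis by simp
      qed
      ultimately show ?thesis using T(1) by blast
    qed
    thus ?thesis unfolding L_def by blast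
  qed
  show ?thesis
  proof (rule exI[of _ "exp (- (18 * b))"], intro conjI exI[of _ "1 / (324 * b)"])
    show "0 < exp (- (18 * b))" "0 < 1 / (324 * b)" using b by simp_all
  qed (use main in blast)
qed

end
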